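(* Let $\mathbf E$ be an $n$-dimensional nilpotent evolution algebra of maximal nilindex in the normal form given in the context, with obstruction index $i_0$. Every ordinary weight-zero Rota--Baxter operator on $\mathbf E$ is local, i.e. $\mathrm{RB}_0(\mathbf E)\subseteq\mathrm{LRB}_0(\mathbf E)$. Moreover, let $T\in\mathrm{LRB}_0(\mathbf E)$. (i) If $T(\mathbf E)\subseteq\mathbb K\mathbf e_n$, then $T\in\mathrm{RB}_0(\mathbf E)$. (ii) If $T$ has nonzero diagonal part and is written as $$T(\mathbf e_i)=\begin{cases} c_i\mathbf e_n, & 1\le i<k,\\ 2^{n-i}\alpha\,\mathbf e_i+c_i\mathbf e_n, & k\le i<n,\\ c_n\mathbf e_n, & i=n,\end{cases}$$ with $k\in\{i_0+1,\dots,n-1\}$, $\alpha\in\mathbb K^\times$ and $c_1,\dots,c_n\in\mathbb K$, then $T\in\mathrm{RB}_0(\mathbf E)$ if and only if $$c_i=0\quad(k<i<n)\qquad\text{and}\qquad c_n=\alpha.$$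
   Context: $\mathbb K$ is a field of characteristic zero and $n\ge 3$. An evolution algebra is an algebra with a basis $\{\mathbf e_1,\dots,\mathbf e_n\}$ (a natural basis) such that $\mathbf e_i\mathbf e_j=0$ for $i\ne j$. Every $n$-dimensional nilpotent evolution algebra of maximal nilindex over $\mathbb K$ admits a natural basis with $$\mathbf e_i^2=\mathbf e_{i+1}+\sum_{j=i+2}^{n-1}a_{ij}\mathbf e_j\ (1\le i\le n-3),\quad \mathbf e_{n-2}^2=\mathbf e_{n-1},\quad \mathbf e_{n-1}^2=\mathbf e_n,\quad \mathbf e_n^2=0,$$ with $a_{ij}\in\mathbb K$; $\mathbf E$ denotes such an algebra with this fixed basis (the normal form). Put $\mathcal I_A=\{(i,j): i+1<j<n,\ a_{ij}\ne0\}$, and define the obstruction index $i_0=0$ if $\mathcal I_A=\varnothing$, and $i_0=\max\{i:(i,j)\in\mathcal I_A\text{ for some }j\}$ otherwise. A linear map $R:\mathbf E\to\mathbf E$ is a Rota--Baxter operator of weight $0$ (also called ordinary) if $R(x)R(y)=R(R(x)y+xR(y))$ for all $x,y\in\mathbf E$; the set of these is $\mathrm{RB}_0(\mathbf E)$. A linear map $T:\mathbf E\to\mathbf E$ is a local Rota--Baxter operator of weight $0$ if for every $x\in\mathbf E$ there is $R_x\in\mathrm{RB}_0(\mathbf E)$ with $T(x)=R_x(x)$; the set of these is $\mathrm{LRB}_0(\mathbf E)$. The paper shows that every $T\in\mathrm{LRB}_0(\mathbf E)$ either has image in $\mathbb K\mathbf e_n$ or has the form displayed in (ii); "nonzero diagonal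 part" refers to the second case. $\mathbb K^\times=\mathbb K\setminus\{0\}$. *)

theory Defs
  imports Complex_Main
begin

locale algebra_over = vector_space scale
  for scale :: "'k::field_char_0 \<Rightarrow> 'v::ab_group_add \<Rightarrow> 'v" (infixr "*s" 75) +
  fixes mult :: "'v \<Rightarrow> 'v \<Rightarrow> 'v" (infixl "\<cdot>" 70)
  assumes mult_linear_right: "Vector_Spaces.linear scale scale (\<lambda>y. x \<cdot> y)"
    and mult_linear_left: "Vector_Spaces.linear scale scale (\<lambda>x. x \<cdot> y)"
begin

text \<open>The power \<open>E\<^sup>m\<close> of a non-associative algebra: \<open>E\<^sup>1 = E\<close> and \<open>E\<^sup>m\<close> is the sum of the
  subspaces \<open>E\<^sup>p E\<^sup>q\<close> over all \<open>p, q \<ge> 1\<close> with \<open>p + q = m\<close>.  The value at \<open>0\<close> is irrelevant.\<close>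

function alg_power :: "nat \<Rightarrow> 'v set" where
  "alg_power m = (if m \<le> 1 then UNIV
     else span (\<Union>p\<in>{1..<m}. {x \<cdot> y | x y. x \<in> alg_power p \<and> y \<in> alg_power (m - p)}))"
  by auto
termination by (relation "Wellfounded.measure id") auto

declare alg_power.simps [simp del]

definition nilpotent :: bool where
  "nilpotent \<longleftrightarrow> (\<exists>m\<ge>1. alg_power m = {0})"

definition nilindex :: nat where
  "nilindex = (LEAST m. 1 \<le> m \<and> alg_power m = {0})"

end

locale evolution_algebra = algebra_over scale mult
  for scale :: "'k::field_char_0 \<Rightarrow> 'v::ab_group_add \<Rightarrow> 'v" (infixr "*s" 75)
    and mult :: "'v \<Rightarrow> 'v \<Rightarrow> 'v" (infixl "\<cdot>" 70) +
  fixes n :: nat and e :: "nat \<Rightarrow> 'v"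
  assumes basis_inj: "inj_on e {1..n}"
    and basis_independent: "independent (e ` {1..n})"
    and basis_span: "span (e ` {1..n}) = UNIV"
    and basis_natural: "\<lbrakk>i \<in> {1..n}; j \<in> {1..n}; i \<noteq> j\<rbrakk> \<Longrightarrow> e i \<cdot> e j = 0"
begin

definition normal_form_squares :: "(nat \<Rightarrow> nat \<Rightarrow> 'k) \<Rightarrow> bool" where
  "normal_form_squares a \<longleftrightarrow>
     (\<forall>i\<in>{1..n - 3}. e i \<cdot> e i = e (i + 1) + (\<Sum>j = i + 2..n - 1. a i j *s e j)) \<and>
     e (n - 2) \<cdot> e (n - 2) = e (n - 1) \<and>
     e (n - 1) \<cdot> e (n - 1) = e n \<and>
     e n \<cdot> e n = 0"

end

text \<open>An \<open>n\<close>-dimensional nilpotent evolution algebra has nilindex at most \<open>2\<^sup>n\<^sup>-\<^sup>1 + 1\<close>.\<close>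

locale max_nilindex_evolution_algebra = evolution_algebra scale mult n e
  for scale :: "'k::field_char_0 \<Rightarrow> 'v::ab_group_add \<Rightarrow> 'v" (infixr "*s" 75)
    and mult :: "'v \<Rightarrow> 'v \<Rightarrow> 'v" (infixl "\<cdot>" 70)
    and n :: nat and e :: "nat \<Rightarrow> 'v" +
  fixes a :: "nat \<Rightarrow> nat \<Rightarrow> 'k"
  assumes n_ge_3: "n \<ge> 3"
    and nilpotent: nilpotent
    and nilindex_maximal: "nilindex = 2 ^ (n - 1) + 1"
    and normal_form: "normal_form_squares a"

text \<open>The two nilpotency conditions of the preceding locale follow from the normal form, so they
  exclude no algebra in normal form.\<close>

context evolution_algebra
begin

lemma mult_simps:
  "(x + y) \<cdot> z = x \<cdot> z + y \<cdot> z" "z \<cdot> (x + y) = z \<cdot> x + z \<cdot> y"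
  "(b *s x) \<cdot> z = b *s (x \<cdot> z)" "z \<cdot> (b *s x) = b *s (z \<cdot> x)"
  "0 \<cdot> z = 0" "z \<cdot> 0 = 0"
proof -
  interpret r: Vector_Spaces.linear scale scale "\<lambda>y. w \<cdot> y" for w by (rule mult_linear_right)
  interpret l: Vector_Spaces.linear scale scale "\<lambda>y. y \<cdot> w" for w by (rule mult_linear_left)
  show "(x + y) \<cdot> z = x \<cdot> z + y \<cdot> z" "z \<cdot> (x + y) = z \<cdot> x + z \<cdot> y"
    "(b *s x) \<cdot> z = b *s (x \<cdot> z)" "z \<cdot> (b *s x) = b *s (z \<cdot> x)"
    "0 \<cdot> z = 0" "z \<cdot> 0 = 0"
    by (rule l.add r.add l.scale r.scale l.zero r.zero)+
qed

definition tail :: "nat \<Rightarrow> 'v set" where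
  "tail j = span (e ` {j + 1..n})"

lemma tail_mono: "j \<le> l \<Longrightarrow> tail l \<subseteq> tail j"
  unfolding tail_def by (intro span_mono image_mono) auto

lemma tail_base: "j < i \<Longrightarrow> i \<le> n \<Longrightarrow> e i \<in> tail j"
  unfolding tail_def by (rule span_base) auto

lemma normal_form_square:
  assumes "normal_form_squares a" "n \<ge> 3" "1 \<le> i" "i < n"
  obtains v where "v \<in> tail (i + 1)" "e i \<cdot> e i = e (i + 1) + v"
proof (cases "i \<le> n - 3")
  case True
  have "(\<Sum>j = i + 2..n - 1. a i j *s e j) \<in> tail (i + 1)"
    unfolding tail_def by (intro span_sum span_scale span_base) auto
  with True assms show ?thesis
    by (intro that[of "\<Sum>j = i + 2..n - 1. a i j *s e j"]) (auto simp: normal_form_squares_def)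
next
  case False
  with assms have "i = n - 2 \<or> i = n - 1" by auto
  with assms have "e i \<cdot> e i = e (i + 1) + 0"
    by (auto simp: normal_form_squares_def numeral_2_eq_2 Suc_diff_Suc)
  then show ?thesis by (rule that[rotated]) (simp add: tail_def span_zero)
qed

lemma basis_product_in_tail:
  assumes "normal_form_squares a" "n \<ge> 3" "i \<in> {1..n}" "l \<in> {1..n}" "j < max i l"
  shows "e i \<cdot> e l \<in> tail (j + 1)"
proof (cases "i = l \<and> i < n")
  case True
  with assms obtain v where v: "v \<in> tail (i + 1)" "e i \<cdot> e i = e (i + 1) + v"
    by (metis atLeastAtMost_iff normal_form_square)
  have "v \<in> tail (j + 1)" using v(1) tail_mono[of "j + 1" "i + 1"] assms True by auto
  moreover have "e (i + 1) \<in> tail (j + 1)" using assms True by (intro tail_base) auto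
  ultimately show ?thesis using True v(2) by (simp add: tail_def span_add)
next
  case False
  with assms have "e i \<cdot> e l = 0"
    by (cases "i = l") (auto simp: normal_form_squares_def intro: basis_natural)
  then show ?thesis by (simp add: tail_def span_zero)
qed

lemma product_in_span:
  assumes "x \<in> span X" "y \<in> span Y" "\<And>u v. u \<in> X \<Longrightarrow> v \<in> Y \<Longrightarrow> u \<cdot> v \<in> span Z"
  shows "x \<cdot> y \<in> span Z"
  using assms(1)
proof (induction rule: span_induct_alt)
  case base
  then show ?case by (simp add: mult_simps span_zero)
next
  case (step b u w)
  have "u \<cdot> y \<in> span Z"
    using assms(2)
  proof (induction rule: span_induct_alt)
    case base
    then show ?case by (simp add: mult_simps span_zero)
  next
    case (step b' u' w')
    with \<open>u \<in> X\<close> assms(3) show ?case by (simp add: mult_simps span_add span_scale)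
  qed
  with step show ?case by (simp add: mult_simps span_add span_scale)
qed

lemma product_in_tail:
  assumes "normal_form_squares a" "n \<ge> 3" "x \<in> tail j \<or> y \<in> tail j"
  shows "x \<cdot> y \<in> tail (j + 1)"
proof -
  have U: "z \<in> span (e ` {1..n})" for z using basis_span by simp
  from assms(3) show ?thesis
  proof
    assume "x \<in> tail j"
    then show ?thesis unfolding tail_def
      by (rule product_in_span[OF _ U])
         (use assms(1,2) basis_product_in_tail[of a] in \<open>auto simp: tail_def\<close>)
  next
    assume "y \<in> tail j"
    then show ?thesis unfolding tail_def
      by (rule product_in_span[OF U])
         (use assms(1,2) basis_product_in_tail[of a] in \<open>auto simp: tail_def\<close>)
  qed
qed

lemma tail_0: "tail 0 = UNIV"
  using basis_span by (simp add: tail_def)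

lemma alg_power_subset_tail:
  assumes "normal_form_squares a" "n \<ge> 3"
  shows "2 ^ j < 2 * m \<Longrightarrow> alg_power m \<subseteq> tail j"
proof (induction j arbitrary: m)
  case 0
  then show ?case by (simp add: tail_0)
next
  case (Suc j)
  then have m: "2 ^ j < m" by simp
  then have m1: "1 < m" using one_le_power[of "2::nat" j] by linarith
  have "x \<cdot> y \<in> tail (Suc j)"
    if p: "p \<in> {1..<m}" "x \<in> alg_power p" "y \<in> alg_power (m - p)" for p x y
  proof -
    have "2 ^ j < 2 * p \<or> 2 ^ j < 2 * (m - p)" using m p(1) by auto
    with p(2,3) Suc.IH have "x \<in> tail j \<or> y \<in> tail j" by blast
    then show ?thesis using product_in_tail[OF assms] by simp
  qed
  then have "(\<Union>p\<in>{1..<m}. {x \<cdot> y | x y. x \<in> alg_power p \<and> y \<in> alg_power (m - p)})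
      \<subseteq> tail (Suc j)"
    by blast
  then have "span (\<Union>p\<in>{1..<m}. {x \<cdot> y | x y. x \<in> alg_power p \<and> y \<in> alg_power (m - p)})
      \<subseteq> tail (Suc j)"
    unfolding tail_def by (rule span_minimal) (rule subspace_span)
  then show ?case using m1 by (subst alg_power.simps) simp
qed

lemma subspace_alg_power: "subspace (alg_power m)"
  by (subst alg_power.simps) (simp add: subspace_UNIV subspace_span)

lemma tail_subset_alg_power:
  assumes nf: "normal_form_squares a" "n \<ge> 3"
  shows "m \<le> 2 ^ j \<Longrightarrow> tail j \<subseteq> alg_power m"
proof (induction j arbitrary: m)
  case 0
  then show ?case by (subst alg_power.simps) simp
next
  case (Suc j)
  show ?case
  proof (cases "m \<le> 1")
    case True
    then show ?thesis by (subst alg_power.simps) simp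
  next
    case False
    define p where "p = m div 2"
    have p: "p \<in> {1..<m}" "p \<le> 2 ^ j" "m - p \<le> 2 ^ j"
      using False Suc.prems by (auto simp: p_def)
    have prod: "x \<cdot> y \<in> alg_power m" if "x \<in> tail j" "y \<in> tail j" for x y
    proof -
      have "x \<in> alg_power p" "y \<in> alg_power (m - p)" using Suc.IH p that by blast+
      with p(1) have "x \<cdot> y \<in> (\<Union>p\<in>{1..<m}. {x \<cdot> y | x y. x \<in> alg_power p \<and> y \<in> alg_power (m - p)})"
        by blast
      with False show ?thesis by (subst alg_power.simps) (simp add: span_base)
    qed
    have "tail l \<subseteq> alg_power m" if "Suc j \<le> l" for l
      using that
    proof (induction "n - l" arbitrary: l)
      case 0
      then have "tail l = {0}" by (simp add: tail_def)
      then show ?case using subspace_alg_power by (simp add: subspace_0)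
    next
      case (Suc d)
      then have l: "1 \<le> l" "l < n" by auto
      then obtain v where v: "v \<in> tail (l + 1)" "e l \<cdot> e l = e (l + 1) + v"
        using normal_form_square[OF nf] by metis
      have IH: "tail (l + 1) \<subseteq> alg_power m" using Suc by auto
      have "e l \<in> tail j" using Suc.prems l by (intro tail_base) auto
      then have "e l \<cdot> e l - v \<in> alg_power m"
        using prod IH v(1) subspace_alg_power by (auto intro: subspace_diff)
      then have "e (l + 1) \<in> alg_power m" using v(2) by simp
      moreover have "e i \<in> alg_power m" if "i \<in> {l + 2..n}" for i
        using IH that tail_base[of "l + 1" i] by auto
      moreover have "{l + 1..n} \<subseteq> insert (l + 1) {l + 2..n}" by auto
      ultimately have "e ` {l + 1..n} \<subseteq> alg_power m" by blast
      then show ?case unfolding tail_def using subspace_alg_power by (rule span_minimal)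
    qed
    then show ?thesis by simp
  qed
qed

lemma max_nilindex_evolution_algebraI:
  assumes "n \<ge> 3" "normal_form_squares a"
  shows "max_nilindex_evolution_algebra scale mult n e a"
proof -
  have z: "alg_power (2 ^ (n - 1) + 1) = {0}"
  proof -
    have "(2::nat) ^ n = 2 * 2 ^ (n - 1)" using assms(1) by (cases n) auto
    then have "alg_power (2 ^ (n - 1) + 1) \<subseteq> tail n"
      using alg_power_subset_tail[OF assms(2,1)] by simp
    then show ?thesis using subspace_0[OF subspace_alg_power] by (auto simp: tail_def)
  qed
  have nz: "alg_power m \<noteq> {0}" if "m \<le> 2 ^ (n - 1)" for m
  proof -
    have "e n \<in> alg_power m"
      using tail_subset_alg_power[OF assms(2,1) that] tail_base[of "n - 1" n] assms(1) by auto
    moreover have "e n \<noteq> 0"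
      using basis_independent dependent_zero[of "e ` {1..n}"] assms(1) by force
    ultimately show ?thesis by blast
  qed
  show ?thesis
  proof
    show "n \<ge> 3" "normal_form_squares a" by fact+
    show nilpotent unfolding nilpotent_def using z by (metis le_add2)
    show "nilindex = 2 ^ (n - 1) + 1" unfolding nilindex_def
    proof (rule Least_equality)
      show "2 ^ (n - 1) + 1 \<le> m" if "1 \<le> m \<and> alg_power m = {0}" for m
        using nz[of m] that by linarith
    qed (use z in simp)
  qed
qed

end

definition index_set :: "nat \<Rightarrow> (nat \<Rightarrow> nat \<Rightarrow> 'k::zero) \<Rightarrow> (nat \<times> nat) set" where
  "index_set n a = {(i, j). 1 \<le> i \<and> i + 1 < j \<and> j < n \<and> a i j \<noteq> 0}"

definition obstruction_index :: "nat \<Rightarrow> (nat \<Rightarrow> nat \<Rightarrow> 'k::zero) \<Rightarrow> nat" where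
  "obstruction_index n a =
     (if index_set n a = {} then 0 else Max {i. \<exists>j. (i, j) \<in> index_set n a})"

definition RB0 :: "('k::field_char_0 \<Rightarrow> 'v::ab_group_add \<Rightarrow> 'v) \<Rightarrow> ('v \<Rightarrow> 'v \<Rightarrow> 'v) \<Rightarrow> ('v \<Rightarrow> 'v) set"
  where
  "RB0 scale mult = {R. Vector_Spaces.linear scale scale R \<and>
     (\<forall>x y. mult (R x) (R y) = R (mult (R x) y + mult x (R y)))}"

definition LRB0 :: "('k::field_char_0 \<Rightarrow> 'v::ab_group_add \<Rightarrow> 'v) \<Rightarrow> ('v \<Rightarrow> 'v \<Rightarrow> 'v) \<Rightarrow> ('v \<Rightarrow> 'v) set"
  where
  "LRB0 scale mult = {T. Vector_Spaces.linear scale scale T \<and>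
     (\<forall>x. \<exists>R\<in>RB0 scale mult. T x = R x)}"

end

theory Submission
  imports Defs
begin

text \<open>
  Every operator in (i) and (ii) has the shape \<open>T(e\<^sub>i) = d\<^sub>i e\<^sub>i + c\<^sub>i e\<^sub>n\<close>.  In the normal form \<open>e\<^sub>n\<close>
  annihilates the whole algebra, so the \<open>c\<^sub>i\<close> disappear as soon as a value of \<open>T\<close> is multiplied by
  anything, and orthogonality of the natural basis makes the Rota--Baxter identity trivial on two
  different basis vectors.  What remains of the identity is the equation
  \<open>d\<^sub>i\<^sup>2 e\<^sub>i\<^sup>2 = 2 d\<^sub>i T(e\<^sub>i\<^sup>2)\<close> for each \<open>i\<close> (\<open>RB0_iff_squares\<close>).  If the image of \<open>T\<close> lies in
  \<open>K e\<^sub>n\<close>, both sides of the Rota--Baxter identity vanish, which is (i).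

  For (ii) the equation is void unless \<open>k \<le> i < n\<close>.  In that range \<open>i\<close> lies above the obstruction
  index, hence \<open>e\<^sub>i\<^sup>2 = e\<^bsub>i+1\<^esub>\<close> exactly (\<open>square_above_obstruction_index\<close>), and after cancelling \<open>d\<^sub>i\<close>
  the equation reads \<open>2 T(e\<^bsub>i+1\<^esub>) = d\<^sub>i e\<^bsub>i+1\<^esub>\<close>.  The weights \<open>2\<^bsup>n-i\<^esup> \<alpha>\<close> halve from each index to
  the next, so the diagonal parts always agree: for \<open>i + 1 < n\<close> the equation says
  \<open>c\<^bsub>i+1\<^esub> = 0\<close>, and for \<open>i + 1 = n\<close> it compares \<open>2 c\<^sub>n\<close> with \<open>2 \<alpha>\<close>.

  The inclusion of \<open>RB\<^sub>0\<close> in \<open>LRB\<^sub>0\<close> holds because an operator agrees with itself at every point.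
\<close>

lemma RB0_subset_LRB0: "RB0 scale mult \<subseteq> LRB0 scale mult"
  by (auto simp: RB0_def LRB0_def)

context evolution_algebra
begin

text \<open>Both sides of the Rota--Baxter identity are bilinear in \<open>x\<close> and \<open>y\<close>.\<close>

lemma RB0_iff_basis:
  assumes T: "Vector_Spaces.linear scale scale T"
  shows "T \<in> RB0 scale mult \<longleftrightarrow>
    (\<forall>i\<in>{1..n}. \<forall>j\<in>{1..n}. T (e i) \<cdot> T (e j) = T (T (e i) \<cdot> e j + e i \<cdot> T (e j)))"
    (is "_ \<longleftrightarrow> ?basis")
proof
  assume "T \<in> RB0 scale mult"
  then show ?basis by (simp add: RB0_def)
next
  assume basis: ?basis
  interpret T: Vector_Spaces.linear scale scale T by (rule T)
  have in_span: "z \<in> span (e ` {1..n})" for z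
    using basis_span by simp
  have left: "T (e i) \<cdot> T y = T (T (e i) \<cdot> y + e i \<cdot> T y)" if "i \<in> {1..n}" for i y
    using in_span[of y]
  proof (induction rule: span_induct_alt)
    case base
    then show ?case by (simp add: mult_simps T.zero)
  next
    case (step b u w)
    then have "T (e i) \<cdot> T u = T (T (e i) \<cdot> u + e i \<cdot> T u)"
      using basis that by blast
    with step.IH show ?case
      by (simp add: mult_simps T.add T.scale scale_right_distrib ac_simps)
  qed
  have "T x \<cdot> T y = T (T x \<cdot> y + x \<cdot> T y)" for x y
    using in_span[of x]
  proof (induction rule: span_induct_alt)
    case base
    then show ?case by (simp add: mult_simps T.zero)
  next
    case (step b u w)
    then have "T u \<cdot> T y = T (T u \<cdot> y + u \<cdot> T y)"
      using left by blast
    with step.IH show ?case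
      by (simp add: mult_simps T.add T.scale scale_right_distrib ac_simps)
  qed
  with T show "T \<in> RB0 scale mult" by (simp add: RB0_def)
qed

end

context max_nilindex_evolution_algebra
begin

lemma last_basis_annihilates: "e n \<cdot> x = 0" "x \<cdot> e n = 0"
proof -
  have basis: "e n \<cdot> e i = 0 \<and> e i \<cdot> e n = 0" if "i \<in> {1..n}" for i
  proof (cases "i = n")
    case True
    then show ?thesis using normal_form by (simp add: normal_form_squares_def)
  next
    case False
    then show ?thesis using that n_ge_3 by (simp add: basis_natural)
  qed
  have "x \<in> span (e ` {1..n})"
    using basis_span by simp
  then have "e n \<cdot> x = 0 \<and> x \<cdot> e n = 0"
    by (induction rule: span_induct_alt) (use basis in \<open>auto simp: mult_simps\<close>)
  then show "e n \<cdot> x = 0" "x \<cdot> e n = 0" by simp_all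
qed

lemma last_basis_nonzero: "e n \<noteq> 0"
  using basis_independent dependent_zero[of "e ` {1..n}"] n_ge_3 by force

text \<open>Above the obstruction index all the coefficients \<open>a\<^bsub>ij\<^esub>\<close> in \<open>e\<^sub>i\<^sup>2\<close> vanish.\<close>

lemma square_above_obstruction_index:
  assumes "obstruction_index n a < i" "i < n"
  shows "e i \<cdot> e i = e (i + 1)"
proof (cases "i \<le> n - 3")
  case True
  have zero: "a i j = 0" if "i + 2 \<le> j" "j \<le> n - 1" for j
  proof (rule ccontr)
    assume "a i j \<noteq> 0"
    with that assms have ij: "(i, j) \<in> index_set n a"
      by (auto simp: index_set_def)
    have "{l. \<exists>j. (l, j) \<in> index_set n a} \<subseteq> {..n}"
      by (auto simp: index_set_def)
    then have "finite {l. \<exists>j. (l, j) \<in> index_set n a}"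
      by (rule finite_subset) simp
    with ij have "i \<le> Max {l. \<exists>j. (l, j) \<in> index_set n a}"
      by (intro Max_ge) auto
    with ij assms show False by (auto simp: obstruction_index_def split: if_splits)
  qed
  have "e i \<cdot> e i = e (i + 1) + (\<Sum>j = i + 2..n - 1. a i j *s e j)"
    using normal_form True assms by (simp add: normal_form_squares_def)
  also have "(\<Sum>j = i + 2..n - 1. a i j *s e j) = 0"
    by (rule sum.neutral) (simp add: zero)
  finally show ?thesis by simp
next
  case False
  with assms have "i = n - 2 \<or> i = n - 1" by auto
  then show ?thesis
    using normal_form n_ge_3
    by (auto simp: normal_form_squares_def numeral_2_eq_2 Suc_diff_Suc)
qed

lemma RB0_if_range_last:
  assumes T: "Vector_Spaces.linear scale scale T"
    and range: "range T \<subseteq> range (\<lambda>b. b *s e n)"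
  shows "T \<in> RB0 scale mult"
proof -
  interpret T: Vector_Spaces.linear scale scale T by (rule T)
  have "T x \<cdot> y = 0 \<and> y \<cdot> T x = 0" for x y
  proof -
    from range obtain b where "T x = b *s e n" by blast
    then show ?thesis by (simp add: mult_simps last_basis_annihilates)
  qed
  with T show ?thesis by (simp add: RB0_def T.zero)
qed

text \<open>
  The terms \<open>c\<^sub>i e\<^sub>n\<close> survive only inside the outer application of \<open>T\<close>: each product in the
  Rota--Baxter identity sees the diagonal part alone, and products of different basis vectors are
  zero.
\<close>

lemma RB0_iff_squares:
  assumes T: "Vector_Spaces.linear scale scale T"
    and T_basis: "\<And>i. i \<in> {1..n} \<Longrightarrow> T (e i) = d i *s e i + c i *s e n"
  shows "T \<in> RB0 scale mult \<longleftrightarrow>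
    (\<forall>i\<in>{1..n}. (d i)\<^sup>2 *s (e i \<cdot> e i) = (2 * d i) *s T (e i \<cdot> e i))"
proof -
  interpret T: Vector_Spaces.linear scale scale T by (rule T)
  have "T (e i) \<cdot> T (e j) = (d i * d j) *s (e i \<cdot> e j)"
    and "T (T (e i) \<cdot> e j + e i \<cdot> T (e j)) = (d i + d j) *s T (e i \<cdot> e j)"
    if "i \<in> {1..n}" "j \<in> {1..n}" for i j
    using that
    by (simp_all add: T_basis mult_simps last_basis_annihilates T.add T.scale scale_left_distrib
        mult.commute)
  moreover have "e i \<cdot> e j = 0" if "i \<in> {1..n}" "j \<in> {1..n}" "i \<noteq> j" for i j
    using that by (rule basis_natural)
  ultimately have "(\<forall>j\<in>{1..n}. T (e i) \<cdot> T (e j) = T (T (e i) \<cdot> e j + e i \<cdot> T (e j))) \<longleftrightarrow>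
      (d i)\<^sup>2 *s (e i \<cdot> e i) = (2 * d i) *s T (e i \<cdot> e i)" if "i \<in> {1..n}" for i
    using that by (metis T.zero mult_2 power2_eq_square scale_zero_right)
  then show ?thesis using RB0_iff_basis[OF T] by simp
qed

theorem RB0_iff_diagonal_form:
  assumes T: "Vector_Spaces.linear scale scale T"
    and k: "k \<in> {obstruction_index n a + 1..n - 1}"
    and \<alpha>: "\<alpha> \<noteq> 0"
    and T_basis: "\<forall>i\<in>{1..n}. T (e i) =
      (if i < k then c i *s e n
       else if i < n then (2 ^ (n - i) * \<alpha>) *s e i + c i *s e n
       else c n *s e n)"
  shows "T \<in> RB0 scale mult \<longleftrightarrow> (\<forall>i. k < i \<and> i < n \<longrightarrow> c i = 0) \<and> c n = \<alpha>"
proof -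
  have k_range: "1 \<le> k" "k < n" "obstruction_index n a < k"
    using k n_ge_3 by auto
  define d where "d i = (if k \<le> i \<and> i < n then 2 ^ (n - i) * \<alpha> else 0)" for i
  have "T (e i) = d i *s e i + c i *s e n" if "i \<in> {1..n}" for i
    using T_basis that k_range by (auto simp: d_def)
  then have squares: "T \<in> RB0 scale mult \<longleftrightarrow>
      (\<forall>i\<in>{1..n}. (d i)\<^sup>2 *s (e i \<cdot> e i) = (2 * d i) *s T (e i \<cdot> e i))"
    by (rule RB0_iff_squares[OF T])
  have weight: "2 ^ (n - i) * \<alpha> = 2 * (2 ^ (n - (i + 1)) * \<alpha>)" if "i < n" for i
    using that by (simp add: Suc_diff_Suc flip: power_Suc)
  have step: "(d i)\<^sup>2 *s (e i \<cdot> e i) = (2 * d i) *s T (e i \<cdot> e i) \<longleftrightarrow>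
      c (i + 1) = (if i + 1 = n then \<alpha> else 0)"
    if i: "k \<le> i" "i < n" for i
  proof -
    have sq: "e i \<cdot> e i = e (i + 1)"
      using i k_range by (intro square_above_obstruction_index) auto
    have d_nz: "d i \<noteq> 0" using i \<alpha> by (simp add: d_def)
    have d_half: "d i = 2 * (2 ^ (n - (i + 1)) * \<alpha>)"
      using weight[of i] i by (simp add: d_def)
    \<comment> \<open>Taken with the weight that continues the halving, the diagonal part at \<open>n\<close> would be \<open>\<alpha> e\<^sub>n\<close>;
      it is actually \<open>0\<close>, so \<open>\<alpha>\<close> is subtracted from \<open>c\<^sub>n\<close>.  This treats \<open>i + 1 = n\<close> and \<open>i + 1 < n\<close>
      uniformly.\<close>
    have T_next: "T (e (i + 1)) = (2 ^ (n - (i + 1)) * \<alpha>) *s e (i + 1) +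
        (c (i + 1) - (if i + 1 = n then \<alpha> else 0)) *s e n"
      using T_basis[rule_format, of "i + 1"] i k_range
      by (cases "i + 1 = n") (auto simp: scale_left_diff_distrib)
    have "(2 * d i) *s T (e (i + 1)) = (d i)\<^sup>2 *s e (i + 1) +
        (2 * d i * (c (i + 1) - (if i + 1 = n then \<alpha> else 0))) *s e n"
      unfolding T_next scale_right_distrib scale_scale
      by (simp add: d_half power2_eq_square algebra_simps)
    then show ?thesis
      using d_nz last_basis_nonzero by (simp add: sq)
  qed
  have "T \<in> RB0 scale mult \<longleftrightarrow>
      (\<forall>i. k \<le> i \<and> i < n \<longrightarrow> c (i + 1) = (if i + 1 = n then \<alpha> else 0))"
  proof -
    have "T \<in> RB0 scale mult \<longleftrightarrow>
        (\<forall>i\<in>{1..n}. k \<le> i \<and> i < n \<longrightarrow>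
          (d i)\<^sup>2 *s (e i \<cdot> e i) = (2 * d i) *s T (e i \<cdot> e i))"
      unfolding squares
    proof (rule ball_cong[OF refl])
      fix i
      have "d i = 0" if "\<not> (k \<le> i \<and> i < n)"
        using that by (auto simp: d_def)
      then show "(d i)\<^sup>2 *s (e i \<cdot> e i) = (2 * d i) *s T (e i \<cdot> e i) \<longleftrightarrow>
          (k \<le> i \<and> i < n \<longrightarrow> (d i)\<^sup>2 *s (e i \<cdot> e i) = (2 * d i) *s T (e i \<cdot> e i))"
        by (cases "k \<le> i \<and> i < n") simp_all
    qed
    also have "\<dots> \<longleftrightarrow> (\<forall>i. k \<le> i \<and> i < n \<longrightarrow> c (i + 1) = (if i + 1 = n then \<alpha> else 0))"
      using step k_range by (meson atLeastAtMost_iff le_trans less_imp_le)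
    finally show ?thesis .
  qed
  also have "\<dots> \<longleftrightarrow> (\<forall>j. k < j \<and> j \<le> n \<longrightarrow> c j = (if j = n then \<alpha> else 0))"
    (is "?shifted \<longleftrightarrow> ?unshifted")
  proof
    assume shifted: ?shifted
    show ?unshifted
    proof (intro allI impI)
      fix j assume "k < j \<and> j \<le> n"
      then show "c j = (if j = n then \<alpha> else 0)"
        using shifted[rule_format, of "j - 1"] by (cases j) auto
    qed
  qed auto
  also have "\<dots> \<longleftrightarrow> (\<forall>i. k < i \<and> i < n \<longrightarrow> c i = 0) \<and> c n = \<alpha>"
    using k_range by (auto simp: le_less)
  finally show ?thesis .
qed

end

theorem corollary3p5:
  fixes scale :: "'k::field_char_0 \<Rightarrow> 'v::ab_group_add \<Rightarrow> 'v"
    and mult :: "'v \<Rightarrow> 'v \<Rightarrow> 'v"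
    and n :: nat
    and e :: "nat \<Rightarrow> 'v"
    and a :: "nat \<Rightarrow> nat \<Rightarrow> 'k"
  assumes "max_nilindex_evolution_algebra scale mult n e a"
  shows "RB0 scale mult \<subseteq> LRB0 scale mult \<and>
    (\<forall>T \<in> LRB0 scale mult.
      (range T \<subseteq> range (\<lambda>b. scale b (e n)) \<longrightarrow> T \<in> RB0 scale mult) \<and>
      (\<forall>k \<alpha> c.
        k \<in> {obstruction_index n a + 1..n - 1} \<longrightarrow> \<alpha> \<noteq> 0 \<longrightarrow>
        (\<forall>i \<in> {1..n}. T (e i) =
           (if i < k then scale (c i) (e n)
            else if i < n then scale (2 ^ (n - i) * \<alpha>) (e i) + scale (c i) (e n)
            else scale (c n) (e n))) \<longrightarrow>
        (T \<in> RB0 scale mult \<longleftrightarrow> (\<forall>i. k < i \<and> i < n \<longrightarrow> c i = 0) \<and> c n = \<alpha>)))"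
proof -
  interpret max_nilindex_evolution_algebra scale mult n e a by (rule assms)
  show ?thesis
  proof (intro conjI ballI allI impI, goal_cases)
    case 1
    then show ?case by (rule RB0_subset_LRB0)
  next
    case (2 T)
    then show ?case by (intro RB0_if_range_last) (simp_all add: LRB0_def)
  next
    case (3 T k \<alpha> c)
    then show ?case by (intro RB0_iff_diagonal_form) (simp_all add: LRB0_def)
  qed
qed

end
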